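(* For every $1<p<\infty$, $$|||\widetilde K|||_{\ell^p}=|||H|||_{\ell^p}$$ and $$|||K|||_{\ell^p}\ge|||H|||_{\ell^p}.$$
   Context: For $1\le p<\infty$, $\ell^p$ is the space of complex-valued sequences $\vec a=(a_j)_{j\in\mathbb{Z}}$ with $\|\vec a\|_{\ell^p}=(\sum_{j\in\mathbb{Z}}|a_j|^p)^{1/p}<\infty$, and $|||L|||_{\ell^p}$ denotes the $\ell^p\to\ell^p$ operator norm of $L$. The discrete Hilbert transform is $$(H(\vec a))_m=\frac1\pi\sum_{n\in\mathbb{Z},\, n\ne m}\frac{a_n}{m-n},\qquad m\in\mathbb{Z},$$ known to be bounded on $\ell^p$ for $1<p<\infty$. The Kak-Hilbert transform is $$K(\vec a)_k=\begin{cases}\displaystyle\frac2\pi\sum_{n\text{ even}}\frac{a_n}{k-n} & k\text{ odd},\\[2mm] \displaystyle\frac2\pi\sum_{n\text{ odd}}\frac{a_n}{k-n} & k\text{ even},\end{cases}\qquad k\in\mathbb{Z}.$$ The operator $\widetilde K$ is defined by $$\widetilde K=2H-K=2\left(\chi_e\circ H\circ\chi_e+\chi_o\circ H\circ\chi_o\right),$$ where $\chi_e(\vec a)_n=a_n$ for $n$ even, $\chi_e(\vec a)_n=0$ for $n$ odd, and $\chi_o(\vec a)=\vec a-\chi_e(\vec a)$. *)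

theory Defs
  imports "HOL-Analysis.Analysis"
begin

definition ell :: "real \<Rightarrow> (int \<Rightarrow> complex) set"
  where "ell p = {a. (\<lambda>j. norm (a j) powr p) summable_on UNIV}"

definition ell_norm :: "real \<Rightarrow> (int \<Rightarrow> complex) \<Rightarrow> real"
  where "ell_norm p a = (\<Sum>\<^sub>\<infinity>j. norm (a j) powr p) powr (1 / p)"

text \<open>The norm is extended-valued: it is \<open>\<infinity>\<close> if \<open>L\<close> is unbounded or does not map into \<open>ell p\<close>, so no
  default value of a real supremum or of a divergent sum can enter.\<close>

definition ell_opnorm :: "real \<Rightarrow> ((int \<Rightarrow> complex) \<Rightarrow> (int \<Rightarrow> complex)) \<Rightarrow> ennreal"
  where "ell_opnorm p L =
    (SUP a \<in> {a \<in> ell p. ell_norm p a \<le> 1}.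
       if L a \<in> ell p then ennreal (ell_norm p (L a)) else \<infinity>)"

definition dht :: "(int \<Rightarrow> complex) \<Rightarrow> (int \<Rightarrow> complex)"
  where "dht a m = 1 / of_real pi * (\<Sum>\<^sub>\<infinity>n\<in>{n. n \<noteq> m}. a n / of_int (m - n))"

definition kak :: "(int \<Rightarrow> complex) \<Rightarrow> (int \<Rightarrow> complex)"
  where "kak a k =
    (if odd k then 2 / of_real pi * (\<Sum>\<^sub>\<infinity>n\<in>{n. even n}. a n / of_int (k - n))
     else 2 / of_real pi * (\<Sum>\<^sub>\<infinity>n\<in>{n. odd n}. a n / of_int (k - n)))"

definition kak_tilde :: "(int \<Rightarrow> complex) \<Rightarrow> (int \<Rightarrow> complex)"
  where "kak_tilde a m = 2 * dht a m - kak a m"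

definition chi_e :: "(int \<Rightarrow> complex) \<Rightarrow> (int \<Rightarrow> complex)"
  where "chi_e a n = (if even n then a n else 0)"

definition chi_o :: "(int \<Rightarrow> complex) \<Rightarrow> (int \<Rightarrow> complex)"
  where "chi_o a n = a n - chi_e a n"

lemma summable_on_abs_int_powr:
  fixes q :: real
  assumes "1 < q"
  shows "(\<lambda>n::int. \<bar>of_int n\<bar> powr (- q)) summable_on UNIV"
proof -
  have nat: "(\<lambda>n::nat. real n powr (- q)) summable_on UNIV"
    using assms by (subst summable_on_UNIV_nonneg_real_iff) (auto simp: summable_real_powr_iff)
  have pos: "(\<lambda>n::int. \<bar>of_int n\<bar> powr (- q)) summable_on {0..}"
    using nat
    by (subst summable_on_reindex_bij_witness[where i = int and j = nat and T = UNIV and h = "\<lambda>n. real n powr (- q)"]) auto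
  have neg: "(\<lambda>n::int. \<bar>of_int n\<bar> powr (- q)) summable_on {..0}"
    using pos
    by (subst summable_on_reindex_bij_witness[where i = uminus and j = uminus and T = "{0..}"
          and h = "\<lambda>n. \<bar>of_int n\<bar> powr (- q)"]) auto
  have "(UNIV :: int set) = {0..} \<union> {..0}" by auto
  then show ?thesis
    using summable_on_union[OF pos neg] by metis
qed

text \<open>For \<open>p > 1\<close> all the series above converge absolutely; the term \<open>n = m\<close> is \<open>a m / 0 = 0\<close>.\<close>

lemma ell_kernel_summable_on:
  assumes p: "1 < p" and a: "a \<in> ell p"
  shows "(\<lambda>n. a n / of_int (m - n)) summable_on S"
proof -
  define q where "q = p / (p - 1)"
  have q: "1 < q" and pq: "1 / p + 1 / q = 1"
    using p by (auto simp: q_def field_simps)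
  have "(\<lambda>n. \<bar>real_of_int (m - n)\<bar> powr (- q)) summable_on UNIV"
    using summable_on_abs_int_powr[OF q]
    by (subst summable_on_reindex_bij_witness[where i = "\<lambda>n. m - n" and j = "\<lambda>n. m - n" and T = UNIV
          and h = "\<lambda>n. \<bar>of_int n\<bar> powr (- q)"]) auto
  then have sum: "(\<lambda>n. norm (a n) powr p / p + \<bar>real_of_int (m - n)\<bar> powr (- q) / q) summable_on UNIV"
    using a unfolding divide_inverse by (intro summable_on_add summable_on_cmult_left) (auto simp: ell_def)
  have le: "norm (a n / of_int (m - n))
      \<le> norm (a n) powr p / p + \<bar>real_of_int (m - n)\<bar> powr (- q) / q" for n
  proof -
    have "norm (a n / of_int (m - n)) = norm (a n) * (1 / \<bar>real_of_int (m - n)\<bar>)"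
      by (simp add: norm_divide flip: of_int_diff)
    also have "\<dots> \<le> norm (a n) powr p / p + (1 / \<bar>real_of_int (m - n)\<bar>) powr q / q"
      using p q pq by (intro Youngs_inequality) auto
    finally show ?thesis
      by (simp add: powr_divide powr_minus_divide)
  qed
  have "(\<lambda>n. norm (a n / of_int (m - n))) summable_on UNIV"
    by (rule summable_on_comparison_test[OF sum]) (use le in auto)
  then have "(\<lambda>n. a n / of_int (m - n)) summable_on UNIV"
    by (rule abs_summable_summable)
  then show ?thesis
    by (rule summable_on_subset_banach) auto
qed

lemma kak_tilde_eq:
  assumes p: "1 < p" and a: "a \<in> ell p"
  shows "kak_tilde a m = 2 * (chi_e (dht (chi_e a)) m + chi_o (dht (chi_o a)) m)"
proof -
  let ?f = "\<lambda>n. a n / of_int (m - n)"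
  have s: "?f summable_on S" for S
    using assms by (rule ell_kernel_summable_on)
  have H: "dht a m = 1 / of_real pi * (infsum ?f {n. even n} + infsum ?f {n. odd n})"
  proof -
    have "infsum ?f {n. n \<noteq> m} = infsum ?f ({n. even n} \<union> {n. odd n})"
      by (rule infsum_cong_neutral) auto
    also have "\<dots> = infsum ?f {n. even n} + infsum ?f {n. odd n}"
      by (rule infsum_Un_disjoint[OF s s]) auto
    finally show ?thesis by (simp add: dht_def)
  qed
  have E: "dht (chi_e a) m = 1 / of_real pi * infsum ?f {n. even n}"
    unfolding dht_def by (intro arg_cong2[where f = "(*)"] refl infsum_cong_neutral) (auto simp: chi_e_def)
  have O: "dht (chi_o a) m = 1 / of_real pi * infsum ?f {n. odd n}"
    unfolding dht_def
    by (intro arg_cong2[where f = "(*)"] refl infsum_cong_neutral) (auto simp: chi_o_def chi_e_def)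
  show ?thesis
    using H E O by (auto simp: kak_tilde_def kak_def chi_o_def chi_e_def algebra_simps)
qed

end

theory Submission
  imports Defs
begin

text \<open>
  Write \<open>H\<close>, \<open>K\<close>, \<open>K'\<close> for \<^const>\<open>dht\<close>, \<^const>\<open>kak\<close>, \<^const>\<open>kak_tilde\<close>, and
  \<open>\<bar>H\<bar>\<close>, \<open>\<bar>K\<bar>\<close>, \<open>\<bar>K'\<bar>\<close> for their operator norms on \<open>\<ell>\<^sup>p\<close>.

  The operator \<open>K'\<close> does not mix parities, and on each parity class it is a copy of \<open>H\<close>: for even
  indices \<open>2/(\<pi>(2i - 2j)) = 1/(\<pi>(i - j))\<close>, and likewise for odd ones (\<open>kak_tilde_parity\<close>). Since
  \<open>\<ell>\<^sup>p\<close> is the \<open>\<ell>\<^sup>p\<close>-direct sum of the sequences living on the even and on the odd integers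
  (\<open>ell_parity_iff\<close>, \<open>ell_norm_parity\<close>), \<open>K'\<close> is isometrically equivalent to the direct sum of two copies of \<open>H\<close>, so
  the two norms agree (\<open>opnorm_kak_tilde\<close>).

  For the inequality, \<open>2H = K + K'\<close> and the triangle inequality give
  \<open>2 \<bar>H\<bar> \<le> \<bar>K\<bar> + \<bar>K'\<bar> = \<bar>K\<bar> + \<bar>H\<bar>\<close>, and \<open>\<bar>H\<bar>\<close> can be cancelled as soon as it is finite.
  Finiteness is the only delicate point. Riesz's theorem would supply it, but much less is enough:
  if \<open>\<bar>K\<bar> = \<infinity>\<close> nothing is to be shown, and if \<open>\<bar>K\<bar> < \<infinity>\<close> then \<open>\<bar>H\<bar> < \<infinity>\<close> follows by comparison
  (\<open>opnorm_dht_finite\<close>). Indeed \<open>K\<close> maps a sequence placed on the even integers to a sequence on the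
  odd integers by convolution with \<open>1/(\<pi>(n + 1/2))\<close>; this differs from the kernel \<open>1/(\<pi> n)\<close> of \<open>H\<close>
  by \<open>O(1/n\<^sup>2)\<close>, and convolution with a summable kernel is bounded on \<open>\<ell>\<^sup>p\<close> (\<open>ell_convolution\<close>).
\<close>

section \<open>A weighted power mean inequality\<close>

text \<open>
  Jensen's inequality for \<open>x \<mapsto> x\<^sup>p\<close> and the weights \<open>w\<close>, equivalently Hoelder's inequality for
  \<open>w\<^bsup>1/q\<^esup>\<close> and \<open>w\<^bsup>1/p\<^esup> x\<close>. Summing Young's inequality for the product \<open>(x/t) \<cdot> 1\<close> bounds
  \<open>\<Sum> w x\<close> for every scale \<open>t > 0\<close>; the best scale satisfies \<open>t\<^sup>p = S / W\<close>. With two weights the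
  inequality yields Minkowski's inequality, with a summable kernel as weights it yields the
  convolution bound.
\<close>

lemma weighted_power_mean:
  fixes w x :: "'a \<Rightarrow> real"
  assumes p: "1 < p" and w0: "\<And>j. 0 \<le> w j" and x0: "\<And>j. 0 \<le> x j"
    and w: "(w has_sum W) A" and wx: "((\<lambda>j. w j * x j powr p) has_sum S) A"
  shows "(\<lambda>j. w j * x j) summable_on A" "(\<Sum>\<^sub>\<infinity>j\<in>A. w j * x j) powr p \<le> W powr (p - 1) * S"
proof -
  define q where "q = p / (p - 1)"
  have q: "1 < q" and pq: "1 / p + 1 / q = 1"
    using p by (auto simp: q_def field_simps)
  have young: "w j * x j \<le> t powr (1 - p) / p * (w j * x j powr p) + t / q * w j" if "0 < t" for t j
  proof -
    have "x j / t * 1 \<le> (x j / t) powr p / p + 1 powr q / q"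
      using p q pq x0 that by (intro Youngs_inequality) auto
    then have "t * (x j / t) \<le> t * ((x j / t) powr p / p + 1 / q)"
      using that by (intro mult_left_mono) auto
    also have "t * ((x j / t) powr p / p + 1 / q) = t powr (1 - p) / p * x j powr p + t / q"
      using that x0 by (simp add: powr_divide powr_diff field_simps)
    finally have "x j \<le> t powr (1 - p) / p * x j powr p + t / q"
      using that by simp
    then have "w j * x j \<le> w j * (t powr (1 - p) / p * x j powr p + t / q)"
      using w0 by (rule mult_left_mono)
    then show ?thesis by (simp add: algebra_simps)
  qed
  have sum: "((\<lambda>j. t powr (1 - p) / p * (w j * x j powr p) + t / q * w j)
      has_sum (t powr (1 - p) / p * S + t / q * W)) A" for t
    by (intro has_sum_add has_sum_cmult_right w wx)
  \<comment> \<open>Summability needs only one scale, here \<open>t = 1\<close>.\<close>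
  show s: "(\<lambda>j. w j * x j) summable_on A"
    by (rule summable_on_comparison_test[OF has_sum_imp_summable[OF sum[of 1]]])
      (use young[of 1] w0 x0 in auto)
  have le: "(\<Sum>\<^sub>\<infinity>j\<in>A. w j * x j) \<le> t powr (1 - p) / p * S + t / q * W" if "0 < t" for t
    by (rule has_sum_mono[OF has_sum_infsum[OF s] sum]) (use young[OF that] in auto)
  have S0: "0 \<le> S" and W0: "0 \<le> W"
    using has_sum_nonneg[OF wx] has_sum_nonneg[OF w] w0 by auto
  show "(\<Sum>\<^sub>\<infinity>j\<in>A. w j * x j) powr p \<le> W powr (p - 1) * S"
  proof (cases "S = 0 \<or> W = 0")
    case True
    \<comment> \<open>The formula for the optimal scale degenerates, but every product \<open>w j * x j\<close> vanishes.\<close>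
    have "w j * x j = 0" if "j \<in> A" for j
    proof (cases "S = 0")
      case True
      then have "w j * x j powr p = 0"
        using nonneg_has_sum_le_0D[OF wx] that w0 by auto
      then show ?thesis by auto
    next
      case False
      then have "w j = 0"
        using nonneg_has_sum_le_0D[OF w] \<open>S = 0 \<or> W = 0\<close> that w0 by auto
      then show ?thesis by simp
    qed
    then have "(\<Sum>\<^sub>\<infinity>j\<in>A. w j * x j) = 0" by (simp add: infsum_0)
    then show ?thesis using S0 by simp
  next
    case False
    then have pos: "0 < S" "0 < W" using S0 W0 by auto
    define t where "t = (S / W) powr (1 / p)"
    have t: "0 < t" and tp: "t powr p = S / W"
      using pos p by (auto simp: t_def powr_powr)
    have "t powr (1 - p) / p * S = t * W / p"
      using t pos by (simp add: powr_diff tp)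
    then have "t powr (1 - p) / p * S + t / q * W = t * W * (1 / p + 1 / q)"
      by (simp add: distrib_left)
    then have "(\<Sum>\<^sub>\<infinity>j\<in>A. w j * x j) \<le> t * W"
      using le[OF t] by (simp only: pq mult_1_right)
    then have "(\<Sum>\<^sub>\<infinity>j\<in>A. w j * x j) powr p \<le> (t * W) powr p"
      using p w0 x0 by (intro powr_mono2) (auto intro: infsum_nonneg)
    also have "\<dots> = W powr (p - 1) * S"
      using t pos by (simp add: powr_mult tp powr_diff)
    finally show ?thesis .
  qed
qed

section \<open>The spaces $\ell^p$\<close>

lemma ell_norm_nonneg: "0 \<le> ell_norm p a"
  by (simp add: ell_norm_def)

lemma ell_norm_powr:
  assumes "0 < p"
  shows "ell_norm p a powr p = (\<Sum>\<^sub>\<infinity>j. norm (a j) powr p)"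
  using assms by (simp add: ell_norm_def powr_powr infsum_nonneg)

lemma ell_norm_le_iff:
  assumes "0 < p" "0 \<le> C"
  shows "ell_norm p a \<le> C \<longleftrightarrow> (\<Sum>\<^sub>\<infinity>j. norm (a j) powr p) \<le> C powr p"
  using ell_norm_powr[OF assms(1), of a] ell_norm_nonneg[of p a] assms
    powr_mono2[of p "ell_norm p a" C] powr_less_mono2[of p C "ell_norm p a"]
  by linarith

lemma ell_normI:
  assumes "0 < p" "0 \<le> C"
    and "f summable_on UNIV" "\<And>j. norm (a j) powr p \<le> f j" "infsum f UNIV \<le> C powr p"
  shows "a \<in> ell p \<and> ell_norm p a \<le> C"
proof -
  have s: "(\<lambda>j. norm (a j) powr p) summable_on UNIV"
    by (rule summable_on_comparison_test[OF assms(3)]) (use assms(4) in auto)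
  have "(\<Sum>\<^sub>\<infinity>j. norm (a j) powr p) \<le> infsum f UNIV"
    by (rule infsum_mono[OF s assms(3)]) (use assms(4) in auto)
  with s assms show ?thesis
    by (simp add: ell_def ell_norm_le_iff)
qed

lemma ell_eq_0_if_norm_0:
  assumes "0 < p" "a \<in> ell p" "ell_norm p a = 0"
  shows "a = (\<lambda>_. 0)"
proof
  fix j
  have "(\<Sum>\<^sub>\<infinity>j. norm (a j) powr p) \<le> 0"
    using ell_norm_powr[OF assms(1), of a] assms(3) by simp
  then have "norm (a j) powr p = 0"
    using assms(2) by (intro nonneg_infsum_le_0D) (auto simp: ell_def)
  then show "a j = 0" by simp
qed

lemma ell_scale:
  assumes "0 < p" "a \<in> ell p"
  shows "(\<lambda>j. c * a j) \<in> ell p" "ell_norm p (\<lambda>j. c * a j) = norm c * ell_norm p a"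
proof -
  have eq: "norm (c * a j) powr p = norm c powr p * norm (a j) powr p" for j
    by (simp add: norm_mult powr_mult)
  show "(\<lambda>j. c * a j) \<in> ell p"
    using assms unfolding ell_def mem_Collect_eq eq by (intro summable_on_cmult_right) simp
  show "ell_norm p (\<lambda>j. c * a j) = norm c * ell_norm p a"
    using assms unfolding ell_norm_def eq
    by (simp add: infsum_cmult_right' powr_mult infsum_nonneg powr_powr)
qed

text \<open>
  The pointwise bound is the power mean inequality for the two values \<open>\<bar>a\<^sub>j\<bar>/\<alpha>\<close> and \<open>\<bar>b\<^sub>j\<bar>/\<beta>\<close> with
  weights \<open>\<alpha>\<close> and \<open>\<beta>\<close>, the norms of \<open>a\<close> and \<open>b\<close>. With these weights the sum over \<open>j\<close> of the right
  hand side is exactly \<open>(\<alpha> + \<beta>)\<^sup>p\<close>.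
\<close>

theorem ell_Minkowski:
  assumes "1 < p" and a: "a \<in> ell p" and b: "b \<in> ell p"
  shows "(\<lambda>j. a j + b j) \<in> ell p" "ell_norm p (\<lambda>j. a j + b j) \<le> ell_norm p a + ell_norm p b"
proof -
  let ?ab = "\<lambda>j. a j + b j"
  have p: "0 < p" using assms by simp
  have "?ab \<in> ell p \<and> ell_norm p ?ab \<le> ell_norm p a + ell_norm p b"
  proof (cases "ell_norm p a = 0 \<or> ell_norm p b = 0")
    case True
    then have "a = (\<lambda>_. 0) \<or> b = (\<lambda>_. 0)"
      using ell_eq_0_if_norm_0 p a b by blast
    then show ?thesis
      using a b ell_norm_nonneg by auto
  next
    case False
    define \<alpha> \<beta> where "\<alpha> = ell_norm p a" and "\<beta> = ell_norm p b"
    have pos: "0 < \<alpha>" "0 < \<beta>"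
      using False ell_norm_nonneg[of p a] ell_norm_nonneg[of p b] by (auto simp: \<alpha>_def \<beta>_def)
    let ?f = "\<lambda>j. (\<alpha> + \<beta>) powr (p - 1) *
      (norm (a j) powr p * \<alpha> powr (1 - p) + norm (b j) powr p * \<beta> powr (1 - p))"
    have sa: "((\<lambda>j. norm (a j) powr p) has_sum \<alpha> powr p) UNIV"
      and sb: "((\<lambda>j. norm (b j) powr p) has_sum \<beta> powr p) UNIV"
      using a b by (auto simp: \<alpha>_def \<beta>_def ell_def ell_norm_powr[OF p])
    have f: "(?f has_sum (\<alpha> + \<beta>) powr (p - 1) * (\<alpha> powr p * \<alpha> powr (1 - p) + \<beta> powr p * \<beta> powr (1 - p))) UNIV"
      by (intro has_sum_cmult_right has_sum_add has_sum_cmult_left sa sb)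
    have "(\<alpha> + \<beta>) powr (p - 1) * (\<alpha> powr p * \<alpha> powr (1 - p) + \<beta> powr p * \<beta> powr (1 - p))
        = (\<alpha> + \<beta>) powr p"
      using pos by (simp add: powr_diff flip: powr_add)
    with f have "(?f has_sum (\<alpha> + \<beta>) powr p) UNIV" by simp
    moreover have "norm (?ab j) powr p \<le> ?f j" for j
    proof -
      have "norm (?ab j) powr p \<le> (norm (a j) + norm (b j)) powr p"
        using p by (intro powr_mono2) (auto simp: norm_triangle_ineq)
      also have "\<dots> \<le> ?f j"
      proof -
        \<comment> \<open>The two weights are indexed by the type of truth values.\<close>
        let ?w = "\<lambda>t. if t then \<alpha> else \<beta>"
        let ?x = "\<lambda>t. if t then norm (a j) / \<alpha> else norm (b j) / \<beta>"
        have "(\<Sum>\<^sub>\<infinity>t\<in>UNIV. ?w t * ?x t) powr p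
            \<le> (\<Sum>t\<in>UNIV. ?w t) powr (p - 1) * (\<Sum>t\<in>UNIV. ?w t * ?x t powr p)"
          using assms(1) pos
          by (intro weighted_power_mean(2)[where w = ?w and x = ?x]) (auto intro: has_sum_finite)
        then have "(norm (a j) + norm (b j)) powr p
            \<le> (\<alpha> + \<beta>) powr (p - 1) * (\<alpha> * (norm (a j) / \<alpha>) powr p + \<beta> * (norm (b j) / \<beta>) powr p)"
          using pos by (simp add: UNIV_bool add.commute)
        then show ?thesis
          using pos by (simp add: powr_divide powr_diff mult.commute)
      qed
      finally show ?thesis .
    qed
    ultimately have "?ab \<in> ell p \<and> ell_norm p ?ab \<le> \<alpha> + \<beta>"
      using p pos by (intro ell_normI[where f = ?f]) (auto simp: infsumI intro: has_sum_imp_summable)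
    then show ?thesis by (simp add: \<alpha>_def \<beta>_def)
  qed
  then show "?ab \<in> ell p" "ell_norm p ?ab \<le> ell_norm p a + ell_norm p b" by auto
qed

section \<open>Operator norms\<close>

text \<open>
  A finite extended norm carries two pieces of information: the operator maps the unit ball into
  \<open>\<ell>\<^sup>p\<close>, and it is bounded there.
\<close>

lemma ell_opnorm_le_iff:
  assumes "0 \<le> C"
  shows "ell_opnorm p L \<le> ennreal C \<longleftrightarrow>
    (\<forall>a \<in> ell p. ell_norm p a \<le> 1 \<longrightarrow> L a \<in> ell p \<and> ell_norm p (L a) \<le> C)"
  unfolding ell_opnorm_def SUP_le_iff using assms by (auto simp: top_unique split: if_splits)

text \<open>Comparing finite upper bounds suffices, because an infinite norm is above everything.\<close>

lemma ell_opnorm_leI: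
  assumes "\<And>C. 0 \<le> C \<Longrightarrow> ell_opnorm p L \<le> ennreal C \<Longrightarrow> ell_opnorm p M \<le> ennreal C"
  shows "ell_opnorm p M \<le> ell_opnorm p L"
  using assms by (cases "ell_opnorm p L") auto

lemma dht_scale: "dht (\<lambda>j. c * a j) = (\<lambda>m. c * dht a m)"
proof
  fix m
  have "(\<Sum>\<^sub>\<infinity>n\<in>{n. n \<noteq> m}. c * a n / of_int (m - n)) = c * (\<Sum>\<^sub>\<infinity>n\<in>{n. n \<noteq> m}. a n / of_int (m - n))"
    by (simp add: infsum_cmult_right' flip: times_divide_eq_right)
  then show "dht (\<lambda>j. c * a j) m = c * dht a m"
    by (simp add: dht_def)
qed

text \<open>
  Homogeneity extends the bound from the unit ball to all of \<open>\<ell>\<^sup>p\<close>. The parity classes of a sequence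
  in the unit ball share its norm between them, so each must be estimated by its own norm.
\<close>

lemma dht_bound:
  assumes p: "0 < p" and C: "0 \<le> C" "ell_opnorm p dht \<le> ennreal C" and a: "a \<in> ell p"
  shows "dht a \<in> ell p" "ell_norm p (dht a) \<le> C * ell_norm p a"
proof -
  have B: "dht b \<in> ell p \<and> ell_norm p (dht b) \<le> C" if "b \<in> ell p" "ell_norm p b \<le> 1" for b
    using C that by (simp add: ell_opnorm_le_iff)
  have "dht a \<in> ell p \<and> ell_norm p (dht a) \<le> C * ell_norm p a"
  proof (cases "ell_norm p a = 0")
    case True
    then have "a = (\<lambda>_. 0)" using ell_eq_0_if_norm_0 p a by blast
    then have "dht a = (\<lambda>_. 0)" by (auto simp: dht_def)
    then show ?thesis using p True by (simp add: ell_def ell_norm_def)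
  next
    case False
    define N where "N = ell_norm p a"
    have N: "0 < N" using False ell_norm_nonneg[of p a] by (simp add: N_def)
    let ?b = "\<lambda>j. of_real (1 / N) * a j"
    have "?b \<in> ell p" "ell_norm p ?b \<le> 1"
      using ell_scale[OF p a, of "of_real (1 / N)"] N by (auto simp: N_def[symmetric] norm_divide)
    then have b: "dht ?b \<in> ell p" "ell_norm p (dht ?b) \<le> C"
      using B by auto
    have eq: "dht a = (\<lambda>m. of_real N * dht ?b m)"
      unfolding dht_scale using N by auto
    have "ell_norm p (dht a) = N * ell_norm p (dht ?b)"
      by (subst eq, subst ell_scale(2)[OF p b(1)]) (use N in auto)
    also have "\<dots> \<le> N * C" using b(2) N by simp
    finally have "ell_norm p (dht a) \<le> C * N" by (simp add: mult.commute)
    moreover have "dht a \<in> ell p"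
      by (subst eq) (rule ell_scale(1)[OF p b(1)])
    ultimately show ?thesis by (simp add: N_def)
  qed
  then show "dht a \<in> ell p" "ell_norm p (dht a) \<le> C * ell_norm p a" by auto
qed

section \<open>Splitting by parity\<close>

lemma bij_betw_even: "bij_betw (\<lambda>j::int. 2 * j) UNIV {n. even n}"
  by (rule bij_betw_byWitness[where f' = "\<lambda>n. n div 2"]) auto

lemma bij_betw_odd: "bij_betw (\<lambda>j::int. 2 * j + 1) UNIV {n. odd n}"
  by (rule bij_betw_byWitness[where f' = "\<lambda>n. n div 2"]) auto

lemma ell_parity_iff:
  "a \<in> ell p \<longleftrightarrow> (\<lambda>j. a (2 * j)) \<in> ell p \<and> (\<lambda>j. a (2 * j + 1)) \<in> ell p" (is "?L \<longleftrightarrow> ?R")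
proof -
  let ?f = "\<lambda>j. norm (a j) powr p"
  have R: "?R \<longleftrightarrow> ?f summable_on {n. even n} \<and> ?f summable_on {n. odd n}"
    using summable_on_reindex_bij_betw[OF bij_betw_even, of ?f]
      summable_on_reindex_bij_betw[OF bij_betw_odd, of ?f] by (simp add: ell_def)
  have U: "(UNIV :: int set) = {n. even n} \<union> {n. odd n}" by auto
  have "?f summable_on UNIV \<longleftrightarrow> ?f summable_on {n. even n} \<and> ?f summable_on {n. odd n}"
    by (subst U) (auto intro: summable_on_union summable_on_subset_banach)
  then show ?thesis
    unfolding R by (simp add: ell_def)
qed

lemma ell_norm_parity:
  assumes p: "0 < p" and a: "a \<in> ell p"
  shows "ell_norm p a powr p =
    ell_norm p (\<lambda>j. a (2 * j)) powr p + ell_norm p (\<lambda>j. a (2 * j + 1)) powr p"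
proof -
  let ?f = "\<lambda>j. norm (a j) powr p"
  have s: "?f summable_on S" for S
    using a by (auto simp: ell_def intro: summable_on_subset_banach)
  have "(UNIV :: int set) = {n. even n} \<union> {n. odd n}" by auto
  then have "infsum ?f UNIV = infsum ?f {n. even n} + infsum ?f {n. odd n}"
    using infsum_Un_disjoint[OF s s, of "{n. even n}" "{n. odd n}"] by auto
  then show ?thesis
    using infsum_reindex_bij_betw[OF bij_betw_even, of ?f]
      infsum_reindex_bij_betw[OF bij_betw_odd, of ?f] by (simp add: ell_norm_powr[OF p])
qed

lemma ell_norm_even_le:
  assumes "0 < p" "a \<in> ell p"
  shows "ell_norm p (\<lambda>j. a (2 * j)) \<le> ell_norm p a"
  using ell_norm_parity[OF assms] powr_ge_zero[of "ell_norm p (\<lambda>j. a (2 * j + 1))" p] assms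
  by (simp add: ell_norm_le_iff ell_norm_nonneg ell_norm_powr)

lemma ell_norm_odd_le:
  assumes "0 < p" "a \<in> ell p"
  shows "ell_norm p (\<lambda>j. a (2 * j + 1)) \<le> ell_norm p a"
  using ell_norm_parity[OF assms] powr_ge_zero[of "ell_norm p (\<lambda>j. a (2 * j))" p] assms
  by (simp add: ell_norm_le_iff ell_norm_nonneg ell_norm_powr)

definition spread :: "(int \<Rightarrow> complex) \<Rightarrow> int \<Rightarrow> complex"
  where "spread b n = (if even n then b (n div 2) else 0)"

lemma spread_even [simp]: "spread b (2 * j) = b j"
  and spread_odd [simp]: "spread b (2 * j + 1) = 0"
  by (auto simp: spread_def)

lemma spread_ell:
  assumes p: "0 < p" and b: "b \<in> ell p"
  shows "spread b \<in> ell p" "ell_norm p (spread b) = ell_norm p b"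
proof -
  have z: "(\<lambda>j. 0) \<in> ell p" "ell_norm p (\<lambda>j. 0) = 0"
    using p by (auto simp: ell_def ell_norm_def)
  show s: "spread b \<in> ell p"
    using b z by (subst ell_parity_iff) auto
  have "ell_norm p (spread b) powr p = ell_norm p b powr p"
    using ell_norm_parity[OF p s] z p by simp
  then have "(ell_norm p (spread b) powr p) powr (1 / p) = (ell_norm p b powr p) powr (1 / p)"
    by simp
  then show "ell_norm p (spread b) = ell_norm p b"
    using p by (simp add: powr_powr ell_norm_nonneg)
qed

section \<open>The parity-preserving part is two copies of the Hilbert transform\<close>

text \<open>
  Dilation by two: between even indices the kernel of \<^const>\<open>dht\<close> is half of its kernel between the
  halved indices.
\<close>

lemma dht_even:
  assumes "\<And>n. odd n \<Longrightarrow> a n = 0"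
  shows "2 * dht a (2 * i) = dht (\<lambda>j. a (2 * j)) i"
proof -
  let ?f = "\<lambda>n. a n / of_int (2 * i - n)"
  have "infsum ?f {n. n \<noteq> 2 * i} = infsum ?f {n. even n}"
    using assms by (intro infsum_cong_neutral) auto
  also have "\<dots> = (\<Sum>\<^sub>\<infinity>j. ?f (2 * j))"
    using infsum_reindex_bij_betw[OF bij_betw_even, of ?f] by simp
  also have "\<dots> = (\<Sum>\<^sub>\<infinity>j\<in>{j. j \<noteq> i}. 1 / 2 * (a (2 * j) / of_int (i - j)))"
    by (intro infsum_cong_neutral) (auto simp: field_simps)
  also have "\<dots> = 1 / 2 * (\<Sum>\<^sub>\<infinity>j\<in>{j. j \<noteq> i}. a (2 * j) / of_int (i - j))"
    by (rule infsum_cmult_right')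
  finally have eq: "infsum ?f {n. n \<noteq> 2 * i} =
      1 / 2 * (\<Sum>\<^sub>\<infinity>j\<in>{j. j \<noteq> i}. a (2 * j) / of_int (i - j))" .
  show ?thesis
    unfolding dht_def eq by simp
qed

lemma dht_shift: "dht (\<lambda>n. a (n + k)) m = dht a (m + k)"
proof -
  have b: "bij_betw (\<lambda>n. n + k) {n. n \<noteq> m} {n. n \<noteq> m + k}"
    by (rule bij_betw_byWitness[where f' = "\<lambda>n. n - k"]) auto
  show ?thesis
    using infsum_reindex_bij_betw[OF b, of "\<lambda>n. a n / of_int (m + k - n)"]
    by (simp add: dht_def)
qed

text \<open>The odd integers reduce to the even ones because \<^const>\<open>dht\<close> commutes with translations.\<close>

lemma kak_tilde_parity:
  assumes "1 < p" "a \<in> ell p"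
  shows "kak_tilde a (2 * i) = dht (\<lambda>j. a (2 * j)) i"
    and "kak_tilde a (2 * i + 1) = dht (\<lambda>j. a (2 * j + 1)) i"
proof -
  show "kak_tilde a (2 * i) = dht (\<lambda>j. a (2 * j)) i"
    using dht_even[of "chi_e a" i] assms by (simp add: kak_tilde_eq chi_e_def chi_o_def)
  have "2 * dht (\<lambda>n. chi_o a (n + 1)) (2 * i) = dht (\<lambda>j. chi_o a (2 * j + 1)) i"
    by (rule dht_even) (auto simp: chi_o_def chi_e_def)
  then show "kak_tilde a (2 * i + 1) = dht (\<lambda>j. a (2 * j + 1)) i"
    using assms dht_shift[of "chi_o a" 1 "2 * i"] by (simp add: kak_tilde_eq chi_e_def chi_o_def)
qed

text \<open>
  For \<open>\<le>\<close> the bound for \<^const>\<open>dht\<close> is applied to both parity classes and the \<open>p\<close>-th powers are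
  added; for \<open>\<ge>\<close> a sequence is placed on the even integers, where \<^const>\<open>kak_tilde\<close> acts on it as
  \<^const>\<open>dht\<close>.
\<close>

theorem opnorm_kak_tilde:
  assumes p: "1 < p"
  shows "ell_opnorm p kak_tilde = ell_opnorm p dht"
proof (rule antisym; rule ell_opnorm_leI)
  fix C :: real
  assume C: "0 \<le> C" and H: "ell_opnorm p dht \<le> ennreal C"
  have p0: "0 < p" using p by simp
  have "kak_tilde a \<in> ell p \<and> ell_norm p (kak_tilde a) \<le> C" if a: "a \<in> ell p" "ell_norm p a \<le> 1" for a
  proof -
    let ?e = "\<lambda>j. a (2 * j)" and ?o = "\<lambda>j. a (2 * j + 1)"
    have eo: "?e \<in> ell p" "?o \<in> ell p"
      using a(1) ell_parity_iff by blast+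
    note K = kak_tilde_parity[OF p a(1)]
    have mem: "kak_tilde a \<in> ell p"
      using dht_bound(1)[OF p0 C H] eo by (subst ell_parity_iff) (simp add: K)
    have "ell_norm p (kak_tilde a) powr p = ell_norm p (dht ?e) powr p + ell_norm p (dht ?o) powr p"
      using ell_norm_parity[OF p0 mem] by (simp add: K)
    also have "\<dots> \<le> (C * ell_norm p ?e) powr p + (C * ell_norm p ?o) powr p"
      using dht_bound(2)[OF p0 C H] eo p0 by (intro add_mono powr_mono2) (auto simp: ell_norm_nonneg)
    also have "\<dots> = C powr p * (ell_norm p ?e powr p + ell_norm p ?o powr p)"
      using C by (simp add: powr_mult ell_norm_nonneg algebra_simps)
    also have "\<dots> = C powr p * ell_norm p a powr p"
      using ell_norm_parity[OF p0 a(1)] by simp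
    also have "\<dots> \<le> C powr p * 1 powr p"
      using a p0 by (intro mult_left_mono powr_mono2) (auto simp: ell_norm_nonneg)
    finally show ?thesis
      using mem p0 C by (simp add: ell_norm_powr ell_norm_le_iff)
  qed
  then show "ell_opnorm p kak_tilde \<le> ennreal C"
    using C by (simp add: ell_opnorm_le_iff)
next
  fix C :: real
  assume C: "0 \<le> C" and K: "ell_opnorm p kak_tilde \<le> ennreal C"
  have p0: "0 < p" using p by simp
  have "dht b \<in> ell p \<and> ell_norm p (dht b) \<le> C" if b: "b \<in> ell p" "ell_norm p b \<le> 1" for b
  proof -
    have s: "spread b \<in> ell p" "ell_norm p (spread b) \<le> 1"
      using spread_ell[OF p0 b(1)] b(2) by auto
    then have k: "kak_tilde (spread b) \<in> ell p" "ell_norm p (kak_tilde (spread b)) \<le> C"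
      using K C by (auto simp: ell_opnorm_le_iff)
    have "(\<lambda>i. kak_tilde (spread b) (2 * i)) = dht b"
      using kak_tilde_parity(1)[OF p s(1)] by auto
    then show ?thesis
      using ell_norm_even_le[OF p0 k(1)] k ell_parity_iff[of "kak_tilde (spread b)" p] by auto
  qed
  then show "ell_opnorm p dht \<le> ennreal C"
    using C by (simp add: ell_opnorm_le_iff)
qed

section \<open>Convolution with a summable kernel\<close>

text \<open>
  Young's inequality for \<open>\<ell>\<^sup>1 * \<ell>\<^sup>p\<close>. The power mean inequality with weights \<open>\<bar>\<kappa>(i - j)\<bar>\<close> bounds the
  \<open>p\<close>-th power of the \<open>i\<close>-th entry by \<open>W\<^bsup>p - 1\<^esup> \<Sum>\<^sub>j \<bar>\<kappa>(i - j)\<bar> \<bar>a\<^sub>j\<bar>\<^sup>p\<close>; exchanging the sums over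
  \<open>i\<close> and \<open>j\<close> then produces one more factor \<open>W = \<Sum> \<bar>\<kappa>\<bar>\<close>.
\<close>

theorem ell_convolution:
  fixes \<kappa> :: "int \<Rightarrow> complex"
  assumes p: "1 < p" and \<kappa>: "(\<lambda>n. norm (\<kappa> n)) summable_on UNIV" and a: "a \<in> ell p"
  shows "(\<lambda>i. \<Sum>\<^sub>\<infinity>j. \<kappa> (i - j) * a j) \<in> ell p \<and>
    ell_norm p (\<lambda>i. \<Sum>\<^sub>\<infinity>j. \<kappa> (i - j) * a j) \<le> (\<Sum>\<^sub>\<infinity>n. norm (\<kappa> n)) * ell_norm p a"
proof -
  define W where "W = (\<Sum>\<^sub>\<infinity>n. norm (\<kappa> n))"
  define U where "U = ell_norm p a powr p"
  have p0: "0 < p" using p by simp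
  have W0: "0 \<le> W" by (simp add: W_def infsum_nonneg)
  have w: "((\<lambda>n. norm (\<kappa> n)) has_sum W) UNIV"
    using \<kappa> by (simp add: W_def)
  have u: "((\<lambda>j. norm (a j) powr p) has_sum U) UNIV"
    using a by (simp add: U_def ell_norm_powr[OF p0] ell_def)
  have w_col: "((\<lambda>i. norm (\<kappa> (i - j))) has_sum W) UNIV" for j
    using w by (subst has_sum_reindex_bij_witness[where i = "\<lambda>n. n + j" and j = "\<lambda>i. i - j" and T = UNIV
          and h = "\<lambda>n. norm (\<kappa> n)"]) auto
  have w_row: "((\<lambda>j. norm (\<kappa> (i - j))) has_sum W) UNIV" for i
    using w by (subst has_sum_reindex_bij_witness[where i = "\<lambda>n. i - n" and j = "\<lambda>j. i - j" and T = UNIV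
          and h = "\<lambda>n. norm (\<kappa> n)"]) auto
  let ?F = "\<lambda>(j, i). norm (\<kappa> (i - j)) * norm (a j) powr p"
  define R where "R i = (\<Sum>\<^sub>\<infinity>j. norm (\<kappa> (i - j)) * norm (a j) powr p)" for i
  have col: "((\<lambda>i. ?F (j, i)) has_sum W * norm (a j) powr p) UNIV" for j
    using has_sum_cmult_left[OF w_col[of j]] by simp
  have tot: "((\<lambda>j. W * norm (a j) powr p) has_sum W * U) UNIV"
    by (rule has_sum_cmult_right[OF u])
  have F: "?F summable_on UNIV \<times> UNIV"
    by (rule summable_on_SigmaI[OF col has_sum_imp_summable[OF tot]]) auto
  have "(?F has_sum W * U) (UNIV \<times> UNIV)"
    by (rule has_sum_SigmaI[OF col tot F])
  then have F': "((\<lambda>(i, j). norm (\<kappa> (i - j)) * norm (a j) powr p) has_sum W * U) (UNIV \<times> UNIV)"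
    by (subst (asm) has_sum_swap) simp
  have row: "((\<lambda>j. norm (\<kappa> (i - j)) * norm (a j) powr p) has_sum R i) UNIV" for i
    using summable_on_SigmaD1[OF has_sum_imp_summable[OF F'], of i] by (simp add: R_def)
  have R: "(R has_sum W * U) UNIV"
    by (rule has_sum_SigmaD[OF F']) (use row in simp)
  note mean = weighted_power_mean[OF p _ _ w_row row]
  have bound: "norm (\<Sum>\<^sub>\<infinity>j. \<kappa> (i - j) * a j) powr p \<le> W powr (p - 1) * R i" for i
  proof -
    have "norm (\<Sum>\<^sub>\<infinity>j. \<kappa> (i - j) * a j) \<le> (\<Sum>\<^sub>\<infinity>j. norm (\<kappa> (i - j)) * norm (a j))"
      using norm_infsum_bound[of "\<lambda>j. \<kappa> (i - j) * a j" UNIV] mean(1)[of i] by (simp add: norm_mult)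
    then have "norm (\<Sum>\<^sub>\<infinity>j. \<kappa> (i - j) * a j) powr p \<le> (\<Sum>\<^sub>\<infinity>j. norm (\<kappa> (i - j)) * norm (a j)) powr p"
      using p0 by (intro powr_mono2) auto
    also have "\<dots> \<le> W powr (p - 1) * R i"
      using mean(2)[of i] by simp
    finally show ?thesis .
  qed
  have "((\<lambda>i. W powr (p - 1) * R i) has_sum W powr (p - 1) * (W * U)) UNIV"
    by (rule has_sum_cmult_right[OF R])
  moreover have "W powr (p - 1) * (W * U) = (W * ell_norm p a) powr p"
    using W0 by (cases "W = 0") (simp_all add: U_def powr_mult powr_diff ell_norm_nonneg)
  ultimately show ?thesis
    unfolding W_def[symmetric] using p0 W0 bound
    by (intro ell_normI[where f = "\<lambda>i. W powr (p - 1) * R i"])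
      (auto simp: ell_norm_nonneg infsumI intro: has_sum_imp_summable)
qed

section \<open>Comparing the two transforms\<close>

text \<open>
  This is \<open>1/n - 1/(n + 1/2)\<close>. At \<open>n = 0\<close> the first term is \<open>1 / 0 = 0\<close>, which matches the diagonal
  omitted in \<^const>\<open>dht\<close>, so one formula covers all \<open>n\<close>.
\<close>

definition half_shift_kernel :: "int \<Rightarrow> complex"
  where "half_shift_kernel n = 1 / of_int n - 2 / of_int (2 * n + 1)"

text \<open>
  Off the origin the two fractions combine to \<open>1/(n (2n + 1))\<close>, and \<open>\<bar>2n + 1\<bar> \<ge> \<bar>n\<bar>\<close> leaves the
  majorant \<open>1/n\<^sup>2\<close>.
\<close>

lemma half_shift_kernel_abs_summable: "(\<lambda>n. norm (half_shift_kernel n)) summable_on UNIV"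
proof -
  have le: "norm (half_shift_kernel n) \<le> (if n = 0 then 2 else 0) + \<bar>of_int n\<bar> powr (- 2)" for n :: int
  proof (cases "n = 0")
    case False
    have nz: "(of_int n :: complex) \<noteq> 0" "(of_int (2 * n + 1) :: complex) \<noteq> 0"
      using False by (simp, subst of_int_eq_0_iff, presburger)
    then have "half_shift_kernel n = 1 / of_int (n * (2 * n + 1))"
      unfolding half_shift_kernel_def by (simp add: field_simps)
    then have "norm (half_shift_kernel n) = 1 / \<bar>of_int (n * (2 * n + 1))\<bar>"
      by (simp only: norm_divide norm_of_int norm_one)
    also have "\<dots> = 1 / (\<bar>of_int n\<bar> * of_int \<bar>2 * n + 1\<bar>)"
      by (simp add: abs_mult)
    also have "\<dots> \<le> 1 / (\<bar>of_int n\<bar> * of_int \<bar>n\<bar>)"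
    proof (intro divide_left_mono mult_left_mono)
      have "\<bar>n\<bar> \<le> \<bar>2 * n + 1\<bar>" using False by presburger
      then show "(of_int \<bar>n\<bar> :: real) \<le> of_int \<bar>2 * n + 1\<bar>" by (simp only: of_int_le_iff)
      have "0 < \<bar>n\<bar>" "0 < \<bar>2 * n + 1\<bar>" using False by presburger+
      then show "(0 :: real) < \<bar>of_int n\<bar> * of_int \<bar>2 * n + 1\<bar> * (\<bar>of_int n\<bar> * of_int \<bar>n\<bar>)"
        unfolding of_int_abs[symmetric] by (intro mult_pos_pos) (simp_all only: of_int_0_less_iff)
    qed auto
    also have "\<dots> = \<bar>of_int n\<bar> powr (- 2)"
      using False by (simp add: powr_minus_divide power2_eq_square)
    finally show ?thesis using False by simp
  qed (simp add: half_shift_kernel_def)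
  have "(\<lambda>n::int. if n = 0 then 2 else 0 :: real) summable_on UNIV"
    by (rule finite_nonzero_values_imp_summable_on) simp
  then have "(\<lambda>n::int. (if n = 0 then 2 else 0) + \<bar>of_int n\<bar> powr (- 2) :: real) summable_on UNIV"
    by (intro summable_on_add summable_on_abs_int_powr) auto
  then show ?thesis
    by (rule summable_on_comparison_test) (use le in auto)
qed

lemma spread_kernel:
  "2 * (spread b (2 * j) / of_int (2 * i + 1 - 2 * j)) = 2 / of_int (2 * (i - j) + 1) * b j"
proof -
  have "2 * i + 1 - 2 * j = 2 * (i - j) + 1" by simp
  then show ?thesis by (simp only: spread_even times_divide_eq_left times_divide_eq_right)
qed

lemma kak_spread_odd:
  "kak (spread b) (2 * i + 1) = 1 / of_real pi * (\<Sum>\<^sub>\<infinity>j. 2 / of_int (2 * (i - j) + 1) * b j)"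
proof -
  let ?f = "\<lambda>n. spread b n / of_int (2 * i + 1 - n)"
  have "infsum ?f {n. even n} = (\<Sum>\<^sub>\<infinity>j. ?f (2 * j))"
    using infsum_reindex_bij_betw[OF bij_betw_even, of ?f] by simp
  also have "2 * \<dots> = (\<Sum>\<^sub>\<infinity>j. 2 * ?f (2 * j))"
    by (rule infsum_cmult_right'[symmetric])
  also have "\<dots> = (\<Sum>\<^sub>\<infinity>j. 2 / of_int (2 * (i - j) + 1) * b j)"
    unfolding spread_kernel ..
  finally show ?thesis by (simp add: kak_def)
qed

lemma dht_eq_kak_spread:
  assumes p: "1 < p" and b: "b \<in> ell p"
  shows "dht b i = kak (spread b) (2 * i + 1)
    + 1 / of_real pi * (\<Sum>\<^sub>\<infinity>j. half_shift_kernel (i - j) * b j)"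
proof -
  have s1: "(\<lambda>j. b j / of_int (i - j)) summable_on UNIV"
    by (rule ell_kernel_summable_on[OF p b])
  have "(\<lambda>n. spread b n / of_int (2 * i + 1 - n)) summable_on {n. even n}"
    by (rule ell_kernel_summable_on[OF p spread_ell(1)]) (use p b in auto)
  then have "(\<lambda>j. spread b (2 * j) / of_int (2 * i + 1 - 2 * j)) summable_on UNIV"
    by (subst summable_on_reindex_bij_betw[OF bij_betw_even,
          of "\<lambda>n. spread b n / of_int (2 * i + 1 - n)"])
  then have "(\<lambda>j. 2 * (spread b (2 * j) / of_int (2 * i + 1 - 2 * j))) summable_on UNIV"
    by (rule summable_on_cmult_right)
  then have s2: "(\<lambda>j. 2 / of_int (2 * (i - j) + 1) * b j) summable_on UNIV"
    unfolding spread_kernel .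
  have "(\<Sum>\<^sub>\<infinity>j. half_shift_kernel (i - j) * b j)
      = (\<Sum>\<^sub>\<infinity>j. b j / of_int (i - j) + - (2 / of_int (2 * (i - j) + 1) * b j))"
    by (rule infsum_cong) (simp add: half_shift_kernel_def left_diff_distrib)
  also have "\<dots> = (\<Sum>\<^sub>\<infinity>j. b j / of_int (i - j)) - (\<Sum>\<^sub>\<infinity>j. 2 / of_int (2 * (i - j) + 1) * b j)"
    using s2 by (subst infsum_add[OF s1]) (simp_all only: summable_on_uminus infsum_uminus diff_conv_add_uminus)
  also have "(\<Sum>\<^sub>\<infinity>j. b j / of_int (i - j)) = (\<Sum>\<^sub>\<infinity>j\<in>{j. j \<noteq> i}. b j / of_int (i - j))"
    by (rule infsum_cong_neutral) auto
  finally have eq: "(\<Sum>\<^sub>\<infinity>j. half_shift_kernel (i - j) * b j)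
      = (\<Sum>\<^sub>\<infinity>j\<in>{j. j \<noteq> i}. b j / of_int (i - j))
        - (\<Sum>\<^sub>\<infinity>j. 2 / of_int (2 * (i - j) + 1) * b j)" .
  show ?thesis
    unfolding kak_spread_odd dht_def eq
    by (simp only: distrib_left[symmetric] add_diff_eq add_diff_cancel_left')
qed

text \<open>
  The explicit bound is \<open>\<bar>H\<bar> \<le> \<bar>K\<bar> + W\<close>, with \<open>W\<close> the sum of the absolute values of
  \<^const>\<open>half_shift_kernel\<close>: the first summand of \<open>dht_eq_kak_spread\<close> is controlled by \<open>K\<close>, the
  second is a convolution.
\<close>

lemma opnorm_dht_finite:
  assumes p: "1 < p" and fin: "ell_opnorm p kak < \<infinity>"
  shows "ell_opnorm p dht < \<infinity>"
proof -
  obtain C where C: "0 \<le> C" "ell_opnorm p kak = ennreal C"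
    using fin by (cases "ell_opnorm p kak") auto
  define W where "W = (\<Sum>\<^sub>\<infinity>n. norm (half_shift_kernel n))"
  have p0: "0 < p" using p by simp
  have W0: "0 \<le> W" by (simp add: W_def infsum_nonneg)
  have "dht b \<in> ell p \<and> ell_norm p (dht b) \<le> C + W" if b: "b \<in> ell p" "ell_norm p b \<le> 1" for b
  proof -
    let ?k = "kak (spread b)" and ?c = "\<lambda>i. \<Sum>\<^sub>\<infinity>j. half_shift_kernel (i - j) * b j"
    have k: "?k \<in> ell p" "ell_norm p ?k \<le> C"
      using C spread_ell[OF p0 b(1)] b(2) ell_opnorm_le_iff[of C p kak] by auto
    then have ko: "(\<lambda>i. ?k (2 * i + 1)) \<in> ell p" "ell_norm p (\<lambda>i. ?k (2 * i + 1)) \<le> C"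
      using ell_parity_iff[of ?k p] ell_norm_odd_le[OF p0 k(1)] by auto
    have c: "?c \<in> ell p" "ell_norm p ?c \<le> W * ell_norm p b"
      using ell_convolution[OF p half_shift_kernel_abs_summable b(1)] by (auto simp: W_def)
    have "ell_norm p ?c \<le> W"
      using c(2) mult_left_mono[OF b(2) W0] by simp
    moreover have "norm (1 / of_real pi :: complex) * ell_norm p ?c \<le> 1 * ell_norm p ?c"
      using pi_gt3 by (intro mult_right_mono) (auto simp: norm_divide ell_norm_nonneg)
    ultimately have c': "(\<lambda>i. 1 / of_real pi * ?c i) \<in> ell p" "ell_norm p (\<lambda>i. 1 / of_real pi * ?c i) \<le> W"
      using ell_scale[OF p0 c(1), of "1 / of_real pi"] by auto
    have "dht b = (\<lambda>i. ?k (2 * i + 1) + 1 / of_real pi * ?c i)"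
      using dht_eq_kak_spread[OF p b(1)] by auto
    then show ?thesis
      using ell_Minkowski[OF p ko(1) c'(1)] ko(2) c'(2) p by simp
  qed
  then have "ell_opnorm p dht \<le> ennreal (C + W)"
    using C W0 by (subst ell_opnorm_le_iff) auto
  then show ?thesis
    by (simp add: order_le_less_trans)
qed

text \<open>
  With \<open>C\<close> and \<open>D\<close> the norms of \<open>K\<close> and \<open>H\<close>, the identity \<open>2H = K + K'\<close> bounds \<open>H\<close> by
  \<open>(C + D) / 2\<close>. Hence \<open>D \<le> (C + D) / 2\<close>, which means \<open>D \<le> C\<close> since \<open>D\<close> is finite.
\<close>

lemma opnorm_dht_le_kak:
  assumes p: "1 < p"
  shows "ell_opnorm p dht \<le> ell_opnorm p kak"
proof (cases "ell_opnorm p kak < \<infinity>")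
  case True
  obtain C where C: "0 \<le> C" "ell_opnorm p kak = ennreal C"
    using True by (cases "ell_opnorm p kak") auto
  obtain D where D: "0 \<le> D" "ell_opnorm p dht = ennreal D"
    using opnorm_dht_finite[OF p True] by (cases "ell_opnorm p dht") auto
  have p0: "0 < p" using p by simp
  have "dht a \<in> ell p \<and> ell_norm p (dht a) \<le> (C + D) / 2" if a: "a \<in> ell p" "ell_norm p a \<le> 1" for a
  proof -
    have K: "kak a \<in> ell p" "ell_norm p (kak a) \<le> C"
      using C a ell_opnorm_le_iff[of C p kak] by auto
    have T: "kak_tilde a \<in> ell p" "ell_norm p (kak_tilde a) \<le> D"
      using D a ell_opnorm_le_iff[of D p kak_tilde] opnorm_kak_tilde[OF p] by auto
    have H: "dht a \<in> ell p"
      using D a ell_opnorm_le_iff[of D p dht] by auto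
    have "ell_norm p (\<lambda>m. 2 * dht a m) = 2 * ell_norm p (dht a)"
      using ell_scale(2)[OF p0 H, of 2] by simp
    moreover have "(\<lambda>m. 2 * dht a m) = (\<lambda>m. kak a m + kak_tilde a m)"
      by (simp add: kak_tilde_def)
    ultimately show ?thesis
      using ell_Minkowski(2)[OF p K(1) T(1)] K(2) T(2) H p by simp
  qed
  then have "ell_opnorm p dht \<le> ennreal ((C + D) / 2)"
    using C D by (subst ell_opnorm_le_iff) auto
  then have "D \<le> (C + D) / 2"
    using C D by (simp add: ennreal_le_iff)
  then show ?thesis
    using C D by (simp add: ennreal_leI)
qed (simp add: not_less top_unique)

theorem theorem3p2:
  fixes p :: real
  assumes "1 < p"
  shows "ell_opnorm p kak_tilde = ell_opnorm p dht \<and> ell_opnorm p kak \<ge> ell_opnorm p dht"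
  using opnorm_kak_tilde[OF assms] opnorm_dht_le_kak[OF assms] by simp

end
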